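(* Let $1\le q<\infty$ and $f\in C_c^1(\mathbb{R}^n)$. Then, for every $x\in\mathbb{R}^n$, $$\lim_{t\to0^+}\frac{m_f^{(q)}(x,t)}{t}=\tilde K_{n,q}|\nabla f(x)|,$$ where $$\tilde K_{n,q}:=\left(\frac1{|B(0,1)|}\int_{B(0,1)}|e\cdot z|^q\,dz\right)^{1/q}=\left(\frac{n}{(n+q)|\mathbb S^{n-1}|}K_{n,q}\right)^{1/q}$$ for any unit vector $e\in\mathbb S^{n-1}$.
   Context: For $1\le q<\infty$ and $t>0$, $m_f^{(q)}(x,t):=\left(\frac1{|B(x,t)|}\int_{B(x,t)}|f(y)-f_{B(x,t)}|^q\,dy\right)^{1/q}$, where $f_{B(x,t)}=\frac1{|B(x,t)|}\int_{B(x,t)}f(y)\,dy$. $K_{n,q}:=\int_{\mathbb S^{n-1}}|e\cdot\theta|^q\,d\theta$, with $d\theta$ unnormalized surface measure, is independent of $e\in\mathbb S^{n-1}$. *)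

theory Defs
  imports "HOL-Analysis.Analysis"
begin

definition gradient :: "(real^'n \<Rightarrow> real) \<Rightarrow> real^'n \<Rightarrow> real^'n" where
  "gradient f x = (THE D. GDERIV f x :> D)"

lemma gradient_eqI:
  assumes "GDERIV f x :> D"
  shows "gradient f x = D"
  unfolding gradient_def
proof (rule the_equality)
  fix E assume "GDERIV f x :> E"
  with assms have "(\<lambda>h. h \<bullet> D) = (\<lambda>h. h \<bullet> E)"
    unfolding gderiv_def by (rule has_derivative_unique)
  then have "\<forall>h. h \<bullet> D = h \<bullet> E"
    by (auto dest: fun_cong)
  then have "D = E"
    by (simp only: vector_eq_ldot)
  then show "E = D" ..
qed (fact assms)

lemma GDERIV_gradient:
  fixes f :: "real^'n \<Rightarrow> real"
  assumes "f differentiable (at x)"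
  shows "GDERIV f x :> gradient f x"
proof -
  obtain f' where f': "(f has_derivative f') (at x)"
    using assms by (auto simp: differentiable_def)
  then interpret linear f'
    by (rule has_derivative_linear)
  define D where "D = (\<Sum>b\<in>Basis. f' b *\<^sub>R b)"
  have *: "f' h = h \<bullet> D" for h
  proof -
    have "f' h = f' (\<Sum>b\<in>Basis. (h \<bullet> b) *\<^sub>R b)"
      by (simp add: euclidean_representation)
    also have "\<dots> = h \<bullet> D"
      by (simp only: sum scale D_def inner_sum_right inner_scaleR_right real_scaleR_def mult.commute)
    finally show ?thesis .
  qed
  have "f' = (\<lambda>h. h \<bullet> D)"
    by (rule ext) (rule *)
  then have "GDERIV f x :> D"
    using f' unfolding gderiv_def by simp
  then show ?thesis
    by (simp only: gradient_eqI)
qed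

definition C1_compact_support :: "(real^'n \<Rightarrow> real) \<Rightarrow> bool" where
  "C1_compact_support f \<longleftrightarrow>
     (\<forall>x. f differentiable (at x)) \<and> continuous_on UNIV (gradient f) \<and>
     compact (closure {x. f x \<noteq> 0})"

definition average :: "(real^'n) set \<Rightarrow> (real^'n \<Rightarrow> real) \<Rightarrow> real" where
  "average A f = 1 / measure lebesgue A * (LINT y:A|lebesgue. f y)"

definition mean_osc :: "real \<Rightarrow> (real^'n \<Rightarrow> real) \<Rightarrow> real^'n \<Rightarrow> real \<Rightarrow> real" where
  "mean_osc q f x t =
     average (ball x t) (\<lambda>y. \<bar>f y - average (ball x t) f\<bar> powr q) powr (1 / q)"

text \<open>Unnormalized surface measure on the unit sphere of n-space, defined via cones:
  \<open>\<sigma>(A) = n \<cdot> |{r \<theta> : 0 < r \<le> 1, \<theta> \<in> A}|\<close>.\<close>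

definition surface_measure :: "(real^'n) measure" where
  "surface_measure =
     scale_measure (of_nat CARD('n))
       (distr (restrict_space lborel (cball 0 1 - {0}))
              (restrict_space borel (sphere 0 1))
              (\<lambda>x. x /\<^sub>R norm x))"

lemma space_surface_measure [simp]:
  "space (surface_measure :: (real^'n) measure) = sphere 0 1"
  by (simp add: surface_measure_def space_scale_measure space_restrict_space)

lemma sets_surface_measure [measurable_cong]:
  "sets (surface_measure :: (real^'n) measure) = sets (restrict_space borel (sphere 0 1))"
  by (simp add: surface_measure_def)

lemma emeasure_surface_measure:
  fixes A :: "(real^'n) set"
  assumes "A \<in> sets borel" "A \<subseteq> sphere 0 1"
  shows "emeasure surface_measure A =
           of_nat CARD('n) * emeasure lborel {r *\<^sub>R \<theta> |r \<theta>. 0 < r \<and> r \<le> 1 \<and> \<theta> \<in> A}"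
proof -
  let ?B = "cball 0 1 - {0} :: (real^'n) set"
  let ?g = "\<lambda>x::real^'n. x /\<^sub>R norm x"
  have g: "?g \<in> restrict_space lborel ?B \<rightarrow>\<^sub>M restrict_space borel (sphere 0 1)"
  proof (rule measurable_restrict_space2)
    show "?g \<in> space (restrict_space lborel ?B) \<rightarrow> sphere 0 1"
      by (auto simp: space_restrict_space)
    show "?g \<in> borel_measurable (restrict_space lborel ?B)"
      by (rule measurable_restrict_space1) measurable
  qed
  have A: "A \<in> sets (restrict_space borel (sphere 0 1))"
    using assms by (auto simp: sets_restrict_space)
  have cone: "?g -` A \<inter> ?B = {r *\<^sub>R \<theta> |r \<theta>. 0 < r \<and> r \<le> 1 \<and> \<theta> \<in> A}"
  proof (intro equalityI subsetI)
    fix x assume x: "x \<in> ?g -` A \<inter> ?B"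
    then have "x = norm x *\<^sub>R ?g x" by simp
    then show "x \<in> {r *\<^sub>R \<theta> |r \<theta>. 0 < r \<and> r \<le> 1 \<and> \<theta> \<in> A}"
      using x by (intro CollectI exI[of _ "norm x"] exI[of _ "?g x"]) auto
  next
    fix x assume "x \<in> {r *\<^sub>R \<theta> |r \<theta>. 0 < r \<and> r \<le> 1 \<and> \<theta> \<in> A}"
    then obtain r \<theta> where x: "x = r *\<^sub>R \<theta>" "0 < r" "r \<le> 1" "\<theta> \<in> A" by blast
    then have "norm \<theta> = 1" using assms(2) by auto
    with x show "x \<in> ?g -` A \<inter> ?B" by auto
  qed
  have "emeasure surface_measure A =
      of_nat CARD('n) * emeasure (restrict_space lborel ?B) (?g -` A \<inter> ?B)"
    unfolding surface_measure_def
    by (simp add: emeasure_distr[OF g A] space_restrict_space)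
  also have "emeasure (restrict_space lborel ?B) (?g -` A \<inter> ?B) = emeasure lborel (?g -` A \<inter> ?B)"
    by (rule emeasure_restrict_space) auto
  finally show ?thesis
    unfolding cone .
qed

definition K_sphere :: "real \<Rightarrow> real^'n \<Rightarrow> real" where
  "K_sphere q e = (LINT \<theta>|surface_measure. \<bar>e \<bullet> \<theta>\<bar> powr q)"

definition K_ball :: "real \<Rightarrow> real^'n \<Rightarrow> real" where
  "K_ball q e = average (ball 0 1) (\<lambda>z. \<bar>e \<bullet> z\<bar> powr q) powr (1 / q)"

end

(* After rescaling the ball to the unit ball B, mean_osc q f x t / t is the L^q-oscillation on B of
the difference quotient (f (x + t z) - f x) / t, which converges uniformly on B to the linear
function z \<bullet> gradient f x. That function has mean zero by symmetry, and rotation invariance turns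
the average of its q-th power into the one for e. The two expressions for the constant agree because
z \<mapsto> \<bar>e \<bullet> (z / norm z)\<bar>^q is homogeneous of degree 0. *)
theory Submission
  imports Defs
begin

section \<open>Lebesgue measure under affine and orthogonal maps\<close>

lemma ball_in_borel [measurable]: "ball c r \<in> sets borel"
  by simp

lemma nn_integral_lborel_affine:
  fixes f :: "'a::euclidean_space \<Rightarrow> ennreal"
  assumes [measurable]: "f \<in> borel_measurable borel" and "c \<noteq> 0"
  shows "(\<integral>\<^sup>+x. f x \<partial>lborel) = ennreal (\<bar>c\<bar> ^ DIM('a)) * (\<integral>\<^sup>+x. f (t + c *\<^sub>R x) \<partial>lborel)"
  by (subst lborel_affine[OF \<open>c \<noteq> 0\<close>, of t])
    (simp add: nn_integral_density nn_integral_distr nn_integral_cmult)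

lemma integral_lborel_affine:
  fixes f :: "'a::euclidean_space \<Rightarrow> real"
  assumes [measurable]: "f \<in> borel_measurable borel" and "c \<noteq> 0"
  shows "(\<integral>x. f x \<partial>lborel) = \<bar>c\<bar> ^ DIM('a) * (\<integral>x. f (t + c *\<^sub>R x) \<partial>lborel)"
  by (subst lborel_affine[OF \<open>c \<noteq> 0\<close>, of t])
    (simp add: integral_density integral_distr)

text \<open>Integrating \<open>f (g x) * indicator B (g x + y)\<close> over \<open>x\<close> and \<open>y\<close> in both orders, where \<open>B\<close> is the
  unit ball, uses only that Lebesgue measure is invariant under translations and reflection and that
  \<open>g\<close> preserves \<open>B\<close>. The change of variables theorem of the library would need a wellordered index
  type.\<close>

lemma nn_integral_lborel_orthogonal:
  fixes f :: "'a::euclidean_space \<Rightarrow> ennreal" and g :: "'a \<Rightarrow> 'a"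
  assumes [measurable]: "f \<in> borel_measurable borel" and g: "orthogonal_transformation g"
  shows "(\<integral>\<^sup>+x. f (g x) \<partial>lborel) = (\<integral>\<^sup>+x. f x \<partial>lborel)"
proof -
  let ?B = "ball 0 1 :: 'a set"
  have lin: "linear g" and norm_g: "norm (g x) = norm x" for x
    using g by (auto simp: orthogonal_transformation_linear orthogonal_transformation_norm)
  have surj: "surj g" by (rule orthogonal_transformation_surj[OF g])
  have [measurable]: "g \<in> borel_measurable borel"
    by (intro borel_measurable_continuous_onI linear_continuous_on)
      (use lin linear_conv_bounded_linear in blast)
  have trans: "(\<integral>\<^sup>+x. k (t + x) \<partial>lborel) = (\<integral>\<^sup>+x. k x \<partial>lborel)"
    if [measurable]: "k \<in> borel_measurable borel" for k :: "'a \<Rightarrow> ennreal" and t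
    using nn_integral_lborel_affine[of k 1 t] by simp
  have refl: "(\<integral>\<^sup>+x. k (t - x) \<partial>lborel) = (\<integral>\<^sup>+x. k x \<partial>lborel)"
    if [measurable]: "k \<in> borel_measurable borel" for k :: "'a \<Rightarrow> ennreal" and t
    using nn_integral_lborel_affine[of k "-1" t] by simp
  have "(\<integral>\<^sup>+x. f (g x) \<partial>lborel) * emeasure lborel ?B
      = (\<integral>\<^sup>+x. f (g x) * (\<integral>\<^sup>+y. indicator ?B y \<partial>lborel) \<partial>lborel)"
    by (simp add: nn_integral_multc)
  \<comment> \<open>For each \<open>x\<close>, translation by \<open>g x\<close> leaves the volume
    of the ball unchanged; this introduces the coupling of \<open>g x\<close> and
    \<open>y\<close>.\<close>
  also have "\<dots> = (\<integral>\<^sup>+x. f (g x) * (\<integral>\<^sup>+y. indicator ?B (g x + y) \<partial>lborel) \<partial>lborel)"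
    by (subst trans) (simp_all)
  also have "\<dots> = (\<integral>\<^sup>+x. (\<integral>\<^sup>+y. f (g x) * indicator ?B (g x + y) \<partial>lborel) \<partial>lborel)"
    by (simp add: nn_integral_cmult)
  also have "\<dots> = (\<integral>\<^sup>+y. (\<integral>\<^sup>+x. f (g x) * indicator ?B (g x + y) \<partial>lborel) \<partial>lborel)"
    by (rule lborel_pair.Fubini') simp
  also have "\<dots> = (\<integral>\<^sup>+y. (\<integral>\<^sup>+x. f (g x - y) * indicator ?B x \<partial>lborel) \<partial>lborel)"
  proof (rule nn_integral_cong)
    fix y
    \<comment> \<open>Writing the shift as \<open>y = g w\<close> lets the substitution of
      \<open>-w + x\<close> for \<open>x\<close> turn \<open>g x + y\<close> into
      \<open>g x\<close>. Then \<open>f\<close> is evaluated at \<open>g x - y\<close>, and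
      \<open>norm (g x) = norm x\<close> removes \<open>g\<close> from the indicator.\<close>
    obtain w where w: "y = g w" using surj by auto
    have "(\<integral>\<^sup>+x. f (g x) * indicator ?B (g x + y) \<partial>lborel)
        = (\<integral>\<^sup>+x. f (g (-w + x)) * indicator ?B (g (-w + x) + y) \<partial>lborel)"
      by (rule trans[symmetric]) simp
    also have "\<dots> = (\<integral>\<^sup>+x. f (g x - y) * indicator ?B x \<partial>lborel)"
      by (intro nn_integral_cong)
        (simp add: w linear_diff[OF lin] indicator_def norm_g)
    finally show "(\<integral>\<^sup>+x. f (g x) * indicator ?B (g x + y) \<partial>lborel)
        = (\<integral>\<^sup>+x. f (g x - y) * indicator ?B x \<partial>lborel)" .
  qed
  also have "\<dots> = (\<integral>\<^sup>+x. (\<integral>\<^sup>+y. f (g x - y) * indicator ?B x \<partial>lborel) \<partial>lborel)"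
    by (rule lborel_pair.Fubini') simp
  \<comment> \<open>For fixed \<open>x\<close> the map sending \<open>y\<close> to
    \<open>g x - y\<close> is a reflection followed by a translation, so the inner integral no
    longer depends on \<open>g\<close>.\<close>
  also have "\<dots> = (\<integral>\<^sup>+x. (\<integral>\<^sup>+y. f y \<partial>lborel) * indicator ?B x \<partial>lborel)"
    by (simp add: nn_integral_multc refl)
  also have "\<dots> = (\<integral>\<^sup>+x. f x \<partial>lborel) * emeasure lborel ?B"
    by (simp add: nn_integral_cmult)
  finally have eq: "(\<integral>\<^sup>+x. f (g x) \<partial>lborel) * emeasure lborel ?B
      = (\<integral>\<^sup>+x. f x \<partial>lborel) * emeasure lborel ?B" .
  \<comment> \<open>The common factor can be cancelled in \<open>ennreal\<close> because it is
    neither 0 nor infinite.\<close>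
  have "emeasure lborel ?B \<noteq> 0" "emeasure lborel ?B \<noteq> top"
    using emeasure_lborel_ball_finite[of "0::'a" 1] content_ball_pos[of 1 "0::'a"]
    by (auto simp: measure_def)
  with eq show ?thesis
    by (metis ennreal_mult_cancel_left mult.commute)
qed

text \<open>The form of the invariance that carries over to Bochner integrals through
  \<open>integral_distr\<close>.\<close>

lemma lborel_distr_orthogonal:
  fixes g :: "'a::euclidean_space \<Rightarrow> 'a"
  assumes g: "orthogonal_transformation g"
  shows "distr lborel borel g = lborel"
proof (rule measure_eqI)
  have [measurable]: "g \<in> borel_measurable borel"
    by (intro borel_measurable_continuous_onI linear_continuous_on)
      (use g orthogonal_transformation_linear linear_conv_bounded_linear in blast)
  fix A assume "A \<in> sets (distr lborel borel g)"
  then have [measurable]: "A \<in> sets borel" by simp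
  have "emeasure (distr lborel borel g) A = (\<integral>\<^sup>+x. indicator A x \<partial>distr lborel borel g)"
    by simp
  also have "\<dots> = (\<integral>\<^sup>+x. indicator A (g x) \<partial>lborel)"
    by (subst nn_integral_distr) simp_all
  also have "\<dots> = emeasure lborel A"
    by (subst nn_integral_lborel_orthogonal[OF _ g]) simp_all
  finally show "emeasure (distr lborel borel g) A = emeasure lborel A" .
qed simp

section \<open>Averages over balls\<close>

lemma set_lebesgue_integral_lborel:
  fixes f :: "'a::euclidean_space \<Rightarrow> real"
  assumes [measurable]: "A \<in> sets borel" "f \<in> borel_measurable borel"
  shows "(LINT y:A|lebesgue. f y) = (LINT y:A|lborel. f y)"
  unfolding set_lebesgue_integral_def by (rule integral_completion) simp

text \<open>Averages are defined by the completed measure, while the changes of variables are stated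
  for \<open>lborel\<close>; for Borel integrands the two integrals coincide.\<close>

lemma average_lborel:
  assumes [measurable]: "A \<in> sets borel" "f \<in> borel_measurable borel"
  shows "average A f = 1 / measure lborel A * (LINT y:A|lborel. f y)"
  by (simp add: average_def set_lebesgue_integral_lborel)

lemma set_integral_ball_affine:
  fixes f :: "'a::euclidean_space \<Rightarrow> real"
  assumes [measurable]: "f \<in> borel_measurable borel" and "0 < t"
  shows "(LINT y:ball x t|lborel. f y)
    = t ^ DIM('a) * (LINT z:ball 0 1|lborel. f (x + t *\<^sub>R z))"
proof -
  have "indicator (ball x t) (x + t *\<^sub>R z) = (indicator (ball 0 1) z :: real)" for z
    using \<open>0 < t\<close> by (simp add: indicator_def dist_norm)
  then show ?thesis
    unfolding set_lebesgue_integral_def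
    by (subst integral_lborel_affine[where c = t and t = x]) (use \<open>0 < t\<close> in simp_all)
qed

lemma average_ball_affine:
  assumes [measurable]: "f \<in> borel_measurable borel" and "0 < t"
  shows "average (ball x t) f = average (ball 0 1) (\<lambda>z. f (x + t *\<^sub>R z))"
proof -
  \<comment> \<open>The volume scales by the same factor as the integral, by the case of the
    constant function 1, so the factor cancels in the average.\<close>
  have "measure lborel (ball x t) = t ^ CARD('a) * measure lborel (ball 0 1 :: (real^'a) set)"
    using set_integral_ball_affine[of "\<lambda>_. 1" t x] \<open>0 < t\<close>
    by (simp add: set_lebesgue_integral_def)
  then show ?thesis
    using \<open>0 < t\<close> by (simp add: average_lborel set_integral_ball_affine[OF assms])
qed

lemma average_cmult: "average A (\<lambda>y. c * f y) = c * average A f"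
  by (simp add: average_def)

text \<open>The reflection \<open>-z\<close> preserves the ball and changes the sign of the
  integrand, so the integral equals its own negative.\<close>

lemma average_ball_inner_eq_0: "average (ball 0 1) (\<lambda>z. z \<bullet> v) = 0"
proof -
  have "(LINT z:ball 0 1|lborel. z \<bullet> v) = (LINT z:ball 0 1|lborel. - (z \<bullet> v))"
    unfolding set_lebesgue_integral_def
    by (subst integral_lborel_affine[where c = "-1" and t = 0]) (simp_all add: indicator_def)
  also have "\<dots> = - (LINT z:ball 0 1|lborel. z \<bullet> v)"
    by (simp add: set_lebesgue_integral_def)
  finally show ?thesis
    by (simp add: average_lborel)
qed

text \<open>Some orthogonal map takes \<open>v\<close> to \<open>norm v *\<^sub>R e\<close>. It
  preserves the ball, the measure and inner products, so the direction of \<open>v\<close> does not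
  matter and only the factor \<open>norm v powr q\<close> is left.\<close>

lemma average_ball_inner_powr:
  fixes v e :: "real^'n"
  assumes "norm e = 1"
  shows "average (ball 0 1) (\<lambda>z. \<bar>z \<bullet> v\<bar> powr q)
    = norm v powr q * average (ball 0 1) (\<lambda>z. \<bar>e \<bullet> z\<bar> powr q)"
proof -
  have "norm v = norm (norm v *\<^sub>R e)" using assms by simp
  then obtain g where g: "orthogonal_transformation g" "g v = norm v *\<^sub>R e"
    by (rule orthogonal_transformation_exists)
  have [measurable]: "g \<in> borel_measurable borel"
    by (intro borel_measurable_continuous_onI linear_continuous_on)
      (use g orthogonal_transformation_linear linear_conv_bounded_linear in blast)
  let ?F = "\<lambda>z. \<bar>z \<bullet> (norm v *\<^sub>R e)\<bar> powr q"
  have "(LINT z:ball 0 1|lborel. ?F z) = (LINT z:ball 0 1|distr lborel borel g. ?F z)"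
    by (simp add: lborel_distr_orthogonal g)
  also have "\<dots> = (LINT z:ball 0 1|lborel. ?F (g z))"
    unfolding set_lebesgue_integral_def
    by (subst integral_distr)
      (simp_all add: indicator_def orthogonal_transformation_norm[OF g(1)])
  also have "\<dots> = (LINT z:ball 0 1|lborel. \<bar>z \<bullet> v\<bar> powr q)"
    using g by (simp add: orthogonal_transformation_def flip: g(2))
  finally have "average (ball 0 1) (\<lambda>z. \<bar>z \<bullet> v\<bar> powr q) = average (ball 0 1) ?F"
    by (simp add: average_lborel)
  also have "?F = (\<lambda>z. norm v powr q * \<bar>e \<bullet> z\<bar> powr q)"
    by (simp add: fun_eq_iff abs_mult powr_mult inner_commute)
  finally show ?thesis
    by (simp add: average_cmult)
qed

section \<open>Uniform convergence and the oscillation at small radius\<close>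

text \<open>The difference of the two averages is at most the supremum over \<open>A\<close> of the
  difference of the integrands.\<close>

lemma tendsto_average:
  fixes g :: "'b \<Rightarrow> real^'n \<Rightarrow> real"
  assumes lim: "uniform_limit A g l F"
    and A: "A \<in> lmeasurable"
    and g: "\<forall>\<^sub>F t in F. set_integrable lebesgue A (g t)"
    and l: "set_integrable lebesgue A l"
  shows "((\<lambda>t. average A (g t)) \<longlongrightarrow> average A l) F"
proof (rule tendstoI)
  fix \<epsilon> :: real assume \<epsilon>: "0 < \<epsilon>"
  have "\<forall>\<^sub>F t in F. \<forall>y\<in>A. dist (g t y) (l y) < \<epsilon> / 2"
    using lim half_gt_zero[OF \<epsilon>] unfolding uniform_limit_iff by blast
  with g show "\<forall>\<^sub>F t in F. dist (average A (g t)) (average A l) < \<epsilon>"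
  proof eventually_elim
    case (elim t)
    have "norm (LINT y:A|lebesgue. g t y - l y) \<le> (LINT y:A|lebesgue. \<epsilon> / 2)"
      unfolding set_lebesgue_integral_def
    proof (rule Bochner_Integration.integral_norm_bound_integral)
      show "integrable lebesgue (\<lambda>y. indicator A y *\<^sub>R (g t y - l y))"
        using set_integral_diff(1)[OF elim(1) l] by (simp add: set_integrable_def)
      show "integrable lebesgue (\<lambda>y. indicator A y *\<^sub>R (\<epsilon> / 2))"
        using A by (auto simp: fmeasurable_def)
    qed (use elim(2) in \<open>auto simp: indicator_def dist_real_def less_imp_le\<close>)
    also have "\<dots> = measure lebesgue A * (\<epsilon> / 2)"
      using A by (simp add: set_lebesgue_integral_def fmeasurable_def)
    finally have *: "\<bar>(LINT y:A|lebesgue. g t y) - (LINT y:A|lebesgue. l y)\<bar>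
        \<le> measure lebesgue A * (\<epsilon> / 2)"
      using set_integral_diff(2)[OF elim(1) l] by simp
    have "dist (average A (g t)) (average A l)
        = \<bar>(LINT y:A|lebesgue. g t y) - (LINT y:A|lebesgue. l y)\<bar> / measure lebesgue A"
      by (simp add: average_def dist_real_def flip: diff_divide_distrib)
    \<comment> \<open>The bound equals \<open>\<epsilon> / 2\<close> if \<open>A\<close> has
      positive measure. If \<open>A\<close> is null, it is 0 because division by 0 gives 0.\<close>
    also have "\<dots> \<le> measure lebesgue A * (\<epsilon> / 2) / measure lebesgue A"
      by (rule divide_right_mono[OF *]) simp
    also have "\<dots> < \<epsilon>"
      using \<epsilon> by simp
    finally show ?case .
  qed
qed

lemma set_integrable_ball_continuous:
  fixes f :: "'a::euclidean_space \<Rightarrow> real"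
  assumes "continuous_on UNIV f"
  shows "set_integrable lebesgue (ball 0 1) f"
proof -
  have [measurable]: "f \<in> borel_measurable borel"
    using assms by (rule borel_measurable_continuous_onI)
  \<comment> \<open>Integrability comes from compactness of the closed ball and is then restricted
    to the open one.\<close>
  have "set_integrable lborel (cball 0 1) f"
    unfolding set_integrable_def
    using borel_integrable_compact[of "cball (0::'a) 1" f] continuous_on_subset[OF assms]
    by (simp add: indicator_scaleR_eq_if)
  then have "set_integrable lborel (ball 0 1) f"
    by (rule set_integrable_subset) auto
  then show ?thesis
    unfolding set_integrable_def by (subst integrable_completion) simp_all
qed

text \<open>On the unit ball the rescaled function is \<open>t * u z + f x\<close>. Subtracting the
  average cancels the constant \<open>f x\<close>, and the factor \<open>t\<close> comes out of the
  oscillation since \<open>(t powr q) powr (1 / q) = t\<close>.\<close>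

lemma mean_osc_over_radius:
  fixes f :: "real^'n \<Rightarrow> real" and x :: "real^'n"
  assumes [measurable]: "f \<in> borel_measurable borel" and "0 < t" "1 \<le> q"
  defines "u \<equiv> \<lambda>z. (f (x + t *\<^sub>R z) - f x) / t"
  assumes u: "set_integrable lebesgue (ball 0 1) u"
  shows "mean_osc q f x t / t
    = average (ball 0 1) (\<lambda>z. \<bar>u z - average (ball 0 1) u\<bar> powr q) powr (1 / q)"
proof -
  let ?B = "ball 0 1 :: (real^'n) set"
  have f_u: "f (x + t *\<^sub>R z) = t * u z + f x" for z
    using \<open>0 < t\<close> by (simp add: u_def)
  have const: "set_integrable lebesgue ?B (\<lambda>_. f x)"
    by (rule set_integrable_ball_continuous) simp
  have "average ?B (\<lambda>z. t * u z + f x) = t * average ?B u + f x"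
  proof -
    have "(LINT z:?B|lebesgue. t * u z + f x) = t * (LINT z:?B|lebesgue. u z) + measure lebesgue ?B * f x"
      using u const by (subst set_integral_add) (simp_all add: set_lebesgue_integral_def)
    \<comment> \<open>Positive volume of the ball is what makes the average of the constant
      \<open>f x\<close> equal to \<open>f x\<close>.\<close>
    moreover have "measure lebesgue ?B \<noteq> 0"
      using content_ball_pos[of 1 "0::real^'n"] by simp
    ultimately show ?thesis
      by (simp add: average_def field_simps)
  qed
  then have avg: "average (ball x t) f = t * average ?B u + f x"
    using \<open>0 < t\<close> by (subst average_ball_affine) (simp_all add: f_u)
  have "mean_osc q f x t
      = average ?B (\<lambda>z. \<bar>t * u z + f x - average (ball x t) f\<bar> powr q) powr (1 / q)"
    unfolding mean_osc_def
    by (subst average_ball_affine) (use \<open>0 < t\<close> in \<open>simp_all add: f_u\<close>)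
  also have "(\<lambda>z. \<bar>t * u z + f x - average (ball x t) f\<bar> powr q)
      = (\<lambda>z. t powr q * \<bar>u z - average ?B u\<bar> powr q)"
  proof
    fix z
    have "t * u z + f x - average (ball x t) f = t * (u z - average ?B u)"
      by (simp add: avg algebra_simps)
    then show "\<bar>t * u z + f x - average (ball x t) f\<bar> powr q
        = t powr q * \<bar>u z - average ?B u\<bar> powr q"
      using \<open>0 < t\<close> by (simp add: abs_mult powr_mult)
  qed
  also have "average ?B \<dots> powr (1 / q)
      = t * average ?B (\<lambda>z. \<bar>u z - average ?B u\<bar> powr q) powr (1 / q)"
    using \<open>0 < t\<close> \<open>1 \<le> q\<close>
    by (simp add: average_cmult powr_mult powr_powr)
  finally show ?thesis
    using \<open>0 < t\<close> by simp
qed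

text \<open>The remainder of the linear approximation at \<open>x\<close> is small relative to
  \<open>t * norm z\<close>, which is less than \<open>t\<close> for all \<open>z\<close> in the
  ball at once; dividing by \<open>t\<close> gives a bound uniform in \<open>z\<close>.\<close>

lemma uniform_limit_difference_quotient:
  fixes f :: "real^'n \<Rightarrow> real"
  assumes "GDERIV f x :> v"
  shows "uniform_limit (ball 0 1) (\<lambda>t z. (f (x + t *\<^sub>R z) - f x) / t) (\<lambda>z. z \<bullet> v) (at_right 0)"
proof (rule uniform_limitI)
  fix \<epsilon> :: real assume "0 < \<epsilon>"
  \<comment> \<open>Half of \<open>\<epsilon>\<close> is used because the estimate is not strict,
    while the final bound must be.\<close>
  then obtain d where d: "0 < d"
      "\<And>y. norm (y - x) < d \<Longrightarrow> norm (f y - f x - (y - x) \<bullet> v) \<le> \<epsilon> / 2 * norm (y - x)"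
    using assms unfolding gderiv_def has_derivative_at_alt by (meson half_gt_zero)
  have "\<forall>\<^sub>F t in at_right 0. 0 < t \<and> t < d"
    using d(1) eventually_at_right_less[of 0] eventually_at_right_real[of 0 d]
    by (auto elim: eventually_mono)
  then show "\<forall>\<^sub>F t in at_right 0. \<forall>z\<in>ball 0 1.
      dist ((f (x + t *\<^sub>R z) - f x) / t) (z \<bullet> v) < \<epsilon>"
  proof eventually_elim
    case (elim t)
    show ?case
    proof
      fix z :: "real^'n" assume "z \<in> ball 0 1"
      then have z: "norm z < 1" by simp
      then have tz: "t * norm z < t" using elim by simp
      have "\<bar>f (x + t *\<^sub>R z) - f x - t * (z \<bullet> v)\<bar> \<le> \<epsilon> / 2 * (t * norm z)"
        using d(2)[of "x + t *\<^sub>R z"] tz elim by simp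
      also have "\<dots> \<le> \<epsilon> / 2 * t"
        using tz \<open>0 < \<epsilon>\<close> by (intro mult_left_mono) auto
      also have "\<dots> < \<epsilon> * t"
        using \<open>0 < \<epsilon>\<close> elim by simp
      finally have "\<bar>f (x + t *\<^sub>R z) - f x - t * (z \<bullet> v)\<bar> / t < \<epsilon>"
        using elim by (simp add: pos_divide_less_eq)
      moreover have "(f (x + t *\<^sub>R z) - f x) / t - z \<bullet> v = (f (x + t *\<^sub>R z) - f x - t * (z \<bullet> v)) / t"
        using elim by (simp add: field_simps)
      ultimately show "dist ((f (x + t *\<^sub>R z) - f x) / t) (z \<bullet> v) < \<epsilon>"
        using elim by (simp add: dist_real_def abs_divide)
    qed
  qed
qed

text \<open>Once \<open>w t\<close> is within 1 of \<open>l\<close>, all values lie in the compact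
  interval of radius \<open>M + 1\<close>, and there \<open>\<bar>s\<bar> powr q\<close> is
  uniformly continuous.\<close>

lemma uniform_limit_abs_powr:
  fixes w :: "'a \<Rightarrow> 'b \<Rightarrow> real"
  assumes lim: "uniform_limit A w l F" and "0 < q" and bound: "\<And>y. y \<in> A \<Longrightarrow> \<bar>l y\<bar> \<le> M"
  shows "uniform_limit A (\<lambda>t y. \<bar>w t y\<bar> powr q) (\<lambda>y. \<bar>l y\<bar> powr q) F"
proof (rule uniform_limit_compose_uniformly_continuous_on[OF lim])
  show "uniformly_continuous_on (cball 0 (M + 1)) (\<lambda>s::real. \<bar>s\<bar> powr q)"
    by (intro compact_uniformly_continuous continuous_on_powr' continuous_intros)
      (use \<open>0 < q\<close> in auto)
  have "\<forall>\<^sub>F t in F. \<forall>y\<in>A. dist (w t y) (l y) < 1"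
    using lim by (auto simp: uniform_limit_iff)
  then show "\<forall>\<^sub>F t in F. \<forall>y\<in>A. w t y \<in> cball 0 (M + 1)"
    by eventually_elim (use bound in \<open>force simp: dist_real_def\<close>)
qed simp

lemma tendsto_mean_osc_over_radius:
  fixes f :: "real^'n \<Rightarrow> real" and v e :: "real^'n"
  assumes "1 \<le> q" "continuous_on UNIV f" "GDERIV f x :> v" "norm e = 1"
  shows "((\<lambda>t. mean_osc q f x t / t) \<longlongrightarrow> K_ball q e * norm v) (at_right 0)"
proof -
  let ?B = "ball 0 1 :: (real^'n) set"
  define u where "u = (\<lambda>t z. (f (x + t *\<^sub>R z) - f x) / t)"
  \<comment> \<open>The recentred quotient: for \<open>t > 0\<close>, the \<open>q\<close>-th root
    of the average of \<open>\<bar>w t z\<bar> powr q\<close> is the oscillation divided by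
    \<open>t\<close>.\<close>
  define w where "w = (\<lambda>t z. u t z - average ?B (u t))"
  have [measurable]: "f \<in> borel_measurable borel"
    using assms(2) by (rule borel_measurable_continuous_onI)
  have cont_u: "continuous_on UNIV (u t)" if "0 < t" for t
    unfolding u_def using that
    by (intro continuous_intros continuous_on_compose2[OF assms(2)]) auto
  have B: "?B \<in> lmeasurable" by simp
  have lim_u: "uniform_limit ?B u (\<lambda>z. z \<bullet> v) (at_right 0)"
    unfolding u_def by (rule uniform_limit_difference_quotient[OF assms(3)])
  have pos: "\<forall>\<^sub>F t::real in at_right 0. 0 < t"
    by (rule eventually_at_right_less)
  have "((\<lambda>t. average ?B (u t)) \<longlongrightarrow> average ?B (\<lambda>z. z \<bullet> v)) (at_right 0)"
    by (rule tendsto_average[OF lim_u B eventually_mono[OF pos]])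
      (auto intro!: set_integrable_ball_continuous cont_u continuous_intros)
  then have "((\<lambda>t. average ?B (u t)) \<longlongrightarrow> 0) (at_right 0)"
    by (simp add: average_ball_inner_eq_0)
  \<comment> \<open>A limit of numbers is a uniform limit of functions constant in \<open>z\<close>,
    so it can be subtracted from \<open>lim_u\<close>.\<close>
  then have "uniform_limit ?B (\<lambda>t _. average ?B (u t)) (\<lambda>_. 0) (at_right 0)"
    by (auto simp: uniform_limit_iff tendsto_iff elim: eventually_mono)
  then have "uniform_limit ?B w (\<lambda>z. z \<bullet> v - 0) (at_right 0)"
    unfolding w_def by (intro uniform_limit_minus lim_u)
  then have "uniform_limit ?B (\<lambda>t z. \<bar>w t z\<bar> powr q) (\<lambda>z. \<bar>z \<bullet> v - 0\<bar> powr q) (at_right 0)"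
  proof (rule uniform_limit_abs_powr)
    fix z :: "real^'n" assume "z \<in> ?B"
    then have "\<bar>z \<bullet> v\<bar> \<le> 1 * norm v"
      by (intro order_trans[OF Cauchy_Schwarz_ineq2] mult_right_mono) auto
    then show "\<bar>z \<bullet> v - 0\<bar> \<le> norm v" by simp
  qed (use \<open>1 \<le> q\<close> in simp)
  then have "((\<lambda>t. average ?B (\<lambda>z. \<bar>w t z\<bar> powr q))
      \<longlongrightarrow> average ?B (\<lambda>z. \<bar>z \<bullet> v - 0\<bar> powr q)) (at_right 0)"
  proof (rule tendsto_average[OF _ B eventually_mono[OF pos]])
    show "set_integrable lebesgue ?B (\<lambda>z. \<bar>z \<bullet> v - 0\<bar> powr q)"
      by (intro set_integrable_ball_continuous continuous_on_powr' continuous_intros)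
        (use \<open>1 \<le> q\<close> in auto)
    show "set_integrable lebesgue ?B (\<lambda>z. \<bar>w t z\<bar> powr q)" if "0 < t" for t
      unfolding w_def
      by (intro set_integrable_ball_continuous continuous_on_powr' continuous_intros cont_u that)
        (use \<open>1 \<le> q\<close> in auto)
  qed
  then have "((\<lambda>t. average ?B (\<lambda>z. \<bar>w t z\<bar> powr q))
      \<longlongrightarrow> norm v powr q * average ?B (\<lambda>z. \<bar>e \<bullet> z\<bar> powr q)) (at_right 0)"
    by (simp add: average_ball_inner_powr[OF assms(4)])
  then have lim: "((\<lambda>t. average ?B (\<lambda>z. \<bar>w t z\<bar> powr q) powr (1 / q))
      \<longlongrightarrow> (norm v powr q * average ?B (\<lambda>z. \<bar>e \<bullet> z\<bar> powr q)) powr (1 / q)) (at_right 0)"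
    \<comment> \<open>The limit of the averages is 0 when \<open>v = 0\<close>. The rule admits a
      zero base because \<open>1 / q\<close> is positive and the averages are nonnegative.\<close>
    by (rule tendsto_powr')
      (use \<open>1 \<le> q\<close> in \<open>auto simp: average_def set_lebesgue_integral_def
        intro!: always_eventually Bochner_Integration.integral_nonneg divide_nonneg_nonneg\<close>)
  have const: "(norm v powr q * average ?B (\<lambda>z. \<bar>e \<bullet> z\<bar> powr q)) powr (1 / q) = K_ball q e * norm v"
    using \<open>1 \<le> q\<close> by (simp add: K_ball_def powr_mult powr_powr)
  have "\<forall>\<^sub>F t in at_right 0.
      average ?B (\<lambda>z. \<bar>w t z\<bar> powr q) powr (1 / q) = mean_osc q f x t / t"
    using pos
  proof eventually_elim
    case (elim t)
    then show ?case
      using mean_osc_over_radius[of f t q x] set_integrable_ball_continuous[OF cont_u[OF elim]] \<open>1 \<le> q\<close>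
      by (simp add: u_def w_def)
  qed
  from Lim_transform_eventually[OF lim this] show ?thesis
    by (simp only: const)
qed

section \<open>Homogeneous functions, ball integrals and surface measure\<close>

text \<open>Replaces integration in polar coordinates: write \<open>1 - norm z powr q\<close> as the integral of
  \<open>q * s powr (q - 1)\<close> over \<open>s\<close> from \<open>norm z\<close> to \<open>1\<close>, exchange the integrals, and use that by
  homogeneity the integral of \<open>h\<close> over the ball of radius \<open>s\<close> is \<open>s ^ DIM('a)\<close> times that over the
  unit ball.\<close>

lemma set_integral_ball_norm_powr:
  fixes h :: "'a::euclidean_space \<Rightarrow> real" and q :: real
  assumes [measurable]: "h \<in> borel_measurable borel"
    and h: "\<And>z. 0 \<le> h z" "\<And>z. h z \<le> 1"
    and homogeneous: "\<And>s z. 0 < s \<Longrightarrow> h (s *\<^sub>R z) = h z"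
    and q: "1 \<le> q"
  shows "(DIM('a) + q) * (LINT z:ball 0 1|lborel. norm z powr q * h z)
    = DIM('a) * (LINT z:ball 0 1|lborel. h z)"
proof -
  define n where "n = DIM('a)"
  let ?B = "ball 0 1 :: 'a set"
  let ?k = "\<lambda>s::real. q * s powr (q - 1)"
  define H where "H = (LINT z:?B|lborel. h z)"
  have intB: "integrable lborel (\<lambda>z. indicator ?B z :: real)"
    using emeasure_lborel_ball_finite[of "0::'a" 1] by simp
  have int_h: "integrable lborel (\<lambda>z. indicator ?B z *\<^sub>R h z)"
    by (rule Bochner_Integration.integrable_bound[OF intB]) (auto simp: h indicator_def)
  have le1: "norm z powr q \<le> 1" if "norm z < 1" for z :: 'a
    using that q powr_mono2[of q "norm z" 1] by simp
  have int_hq: "integrable lborel (\<lambda>z. indicator ?B z *\<^sub>R (norm z powr q * h z))"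
    by (rule Bochner_Integration.integrable_bound[OF intB])
      (auto simp: h indicator_def intro!: mult_le_one le1)
  have H0: "0 \<le> H" unfolding H_def set_lebesgue_integral_def
    by (intro Bochner_Integration.integral_nonneg) (simp add: h)
  have nn_h: "(\<integral>\<^sup>+z. indicator ?B z * ennreal (h z) \<partial>lborel) = ennreal H"
  proof -
    have "(\<integral>\<^sup>+z. indicator ?B z * ennreal (h z) \<partial>lborel) = (\<integral>\<^sup>+z. ennreal (indicator ?B z *\<^sub>R h z) \<partial>lborel)"
      by (intro nn_integral_cong) (simp add: indicator_def)
    also have "\<dots> = ennreal H" unfolding H_def set_lebesgue_integral_def
      by (rule nn_integral_eq_integral[OF int_h]) (simp add: h)
    finally show ?thesis .
  qed
  \<comment> \<open>The point \<open>z = 0\<close> is excluded since \<open>s powr q\<close> is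
    differentiated at every \<open>s\<close> in \<open>{norm z..1}\<close>, which has to avoid 0. It
    is a null set in the later integral over \<open>z\<close>.\<close>
  have inner_z: "(\<integral>\<^sup>+s. ennreal (?k s) * indicator {0..1} s * (if norm z < s then ennreal (h z) else 0) \<partial>lborel)
      = ennreal (indicator ?B z *\<^sub>R (h z - norm z powr q * h z))" if "z \<noteq> 0" for z
  proof (cases "norm z < 1")
    case True
    have "(\<integral>\<^sup>+s. ennreal (?k s) * indicator {norm z..1} s \<partial>lborel) = ennreal (1 powr q - norm z powr q)"
    proof (rule nn_integral_FTC_Icc)
      fix s assume "s \<in> {norm z..1}"
      then have "0 < s" using that by (auto intro: less_le_trans[of 0 "norm z"])
      then show "((\<lambda>s. s powr q) has_real_derivative ?k s) (at s)"
        by (auto intro!: derivative_eq_intros)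
      show "0 \<le> ?k s" using q by simp
    qed (use True in auto)
    \<comment> \<open>The condition \<open>norm z < s\<close> omits the endpoint
      \<open>s = norm z\<close>, where the two integrands may differ, so they are compared almost
      everywhere.\<close>
    moreover have "(\<integral>\<^sup>+s. ennreal (?k s) * indicator {0..1} s * (if norm z < s then ennreal (h z) else 0) \<partial>lborel)
       = (\<integral>\<^sup>+s. ennreal (?k s) * indicator {norm z..1} s * ennreal (h z) \<partial>lborel)"
    proof (rule nn_integral_cong_AE)
      show "AE s in lborel. ennreal (?k s) * indicator {0..1} s * (if norm z < s then ennreal (h z) else 0)
          = ennreal (?k s) * indicator {norm z..1} s * ennreal (h z)"
        using AE_lborel_singleton[of "norm z"]
        by eventually_elim (use norm_ge_zero[of z] in \<open>auto simp: indicator_def simp del: norm_ge_zero\<close>)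
    qed
    moreover have "\<dots> = (\<integral>\<^sup>+s. ennreal (?k s) * indicator {norm z..1} s \<partial>lborel) * ennreal (h z)"
      by (rule nn_integral_multc) simp
    moreover have "ennreal (1 powr q - norm z powr q) * ennreal (h z)
        = ennreal (indicator ?B z *\<^sub>R (h z - norm z powr q * h z))"
      using True le1[OF True] h[of z] by (simp add: left_diff_distrib flip: ennreal_mult)
    ultimately show ?thesis by simp
  next
    case False
    have "(\<integral>\<^sup>+s. ennreal (?k s) * indicator {0..1} s * (if norm z < s then ennreal (h z) else 0) \<partial>lborel)
        = (\<integral>\<^sup>+(s::real). 0 \<partial>lborel)"
    proof (rule nn_integral_cong)
      show "ennreal (?k s) * indicator {0..1} s * (if norm z < s then ennreal (h z) else 0) = 0" for s
        using False by (cases "s \<le> 1") simp_all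
    qed
    also have "\<dots> = ennreal (indicator ?B z *\<^sub>R (h z - norm z powr q * h z))"
      using False by simp
    finally show ?thesis .
  qed
  have inner_s: "(\<integral>\<^sup>+z. (if norm z < s then ennreal (h z) else 0) \<partial>lborel) = ennreal (s ^ n * H)" if "0 < s" for s
  proof -
    have "(\<integral>\<^sup>+z. (if norm z < s then ennreal (h z) else 0) \<partial>lborel)
        = ennreal (s ^ n) * (\<integral>\<^sup>+z. (if norm (0 + s *\<^sub>R z) < s then ennreal (h (0 + s *\<^sub>R z)) else 0) \<partial>lborel)"
      using nn_integral_lborel_affine[of "\<lambda>z. if norm z < s then ennreal (h z) else 0" s 0] that
      by (simp add: n_def)
    also have "(\<integral>\<^sup>+z. (if norm (0 + s *\<^sub>R z) < s then ennreal (h (0 + s *\<^sub>R z)) else 0) \<partial>lborel)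
        = (\<integral>\<^sup>+z. indicator ?B z * ennreal (h z) \<partial>lborel)"
      using that by (intro nn_integral_cong) (simp add: homogeneous indicator_def)
    finally show ?thesis
      using nn_h H0 that by (simp add: ennreal_mult)
  qed
  have "ennreal (LINT z:?B|lborel. h z - norm z powr q * h z)
      = (\<integral>\<^sup>+z. ennreal (indicator ?B z *\<^sub>R (h z - norm z powr q * h z)) \<partial>lborel)"
    unfolding set_lebesgue_integral_def
  proof (rule nn_integral_eq_integral[symmetric])
    show "integrable lborel (\<lambda>z. indicator ?B z *\<^sub>R (h z - norm z powr q * h z))"
      using Bochner_Integration.integrable_diff[OF int_h int_hq] by (simp add: algebra_simps)
    show "AE z in lborel. 0 \<le> indicator ?B z *\<^sub>R (h z - norm z powr q * h z)"
      using h le1 by (auto simp: indicator_def intro!: mult_left_le_one_le)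
  qed
  also have "\<dots> = (\<integral>\<^sup>+z. (\<integral>\<^sup>+s. ennreal (?k s) * indicator {0..1} s * (if norm z < s then ennreal (h z) else 0) \<partial>lborel) \<partial>lborel)"
  proof (rule nn_integral_cong_AE)
    show "AE z in lborel. ennreal (indicator ?B z *\<^sub>R (h z - norm z powr q * h z)) =
        (\<integral>\<^sup>+s. ennreal (?k s) * indicator {0..1} s * (if norm z < s then ennreal (h z) else 0) \<partial>lborel)"
      using AE_lborel_singleton[of "0::'a"] by eventually_elim (rule inner_z[symmetric])
  qed
  also have "\<dots> = (\<integral>\<^sup>+s. (\<integral>\<^sup>+z. ennreal (?k s) * indicator {0..1} s * (if norm z < s then ennreal (h z) else 0) \<partial>lborel) \<partial>lborel)"
    by (rule lborel_pair.Fubini') simp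
  also have "\<dots> = (\<integral>\<^sup>+s. ennreal (s powr (n + q - 1)) * indicator {0..1} s * ennreal (q * H) \<partial>lborel)"
  proof (rule nn_integral_cong)
    fix s :: real
    show "(\<integral>\<^sup>+z. ennreal (?k s) * indicator {0..1} s * (if norm z < s then ennreal (h z) else 0) \<partial>lborel)
        = ennreal (s powr (n + q - 1)) * indicator {0..1} s * ennreal (q * H)"
    proof (cases "0 < s")
      case True
      \<comment> \<open>The factor \<open>s ^ n\<close> comes from the ball of radius
        \<open>s\<close>, the other from the weight \<open>?k s\<close>.\<close>
      have "s powr (n + q - 1) = s ^ n * s powr (q - 1)"
        using True by (simp add: powr_add powr_diff powr_realpow)
      then have "ennreal (?k s) * ennreal (s ^ n * H) = ennreal (s powr (n + q - 1)) * ennreal (q * H)"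
        using H0 q True by (simp add: mult_ac flip: ennreal_mult)
      then show ?thesis
        using True by (subst nn_integral_cmult) (simp_all add: inner_s mult_ac)
    next
      case False
      \<comment> \<open>For \<open>s < 0\<close> the indicator vanishes. At \<open>s = 0\<close> the
        left side vanishes because \<open>norm z < 0\<close> is impossible, and the right side
        because \<open>0 powr a = 0\<close>.\<close>
      then consider "s < 0" | "s = 0" by linarith
      then show ?thesis by cases simp_all
    qed
  qed
  also have "\<dots> = ennreal (1 / (n + q)) * ennreal (q * H)"
  proof -
    have "((\<lambda>s::real. s powr (n + q - 1)) has_integral (1 powr (n + q - 1 + 1) / (n + q - 1 + 1))) {0..1}"
      using q by (intro has_integral_powr_from_0) auto
    from nn_integral_has_integral_lebesgue'[OF _ this]
    have "(\<integral>\<^sup>+s. ennreal (s powr (n + q - 1)) * indicator {0..1} s \<partial>lborel) = ennreal (1 / (n + q))"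
      by simp
    then show ?thesis by (simp add: nn_integral_multc)
  qed
  also have "\<dots> = ennreal (q * H / (n + q))"
    using q H0 by (simp flip: ennreal_mult)
  finally have "(LINT z:?B|lborel. h z - norm z powr q * h z) = q * H / (n + q)"
  proof (rule ennreal_inj[THEN iffD1, rotated 2])
    show "0 \<le> (LINT z:?B|lborel. h z - norm z powr q * h z)"
      unfolding set_lebesgue_integral_def
      using h le1 by (intro Bochner_Integration.integral_nonneg) (auto simp: indicator_def intro!: mult_left_le_one_le)
    show "0 \<le> q * H / (n + q)" using q H0 by simp
  qed
  moreover have "(LINT z:?B|lborel. h z - norm z powr q * h z)
      = H - (LINT z:?B|lborel. norm z powr q * h z)"
    unfolding H_def using int_h int_hq by (intro set_integral_diff) (auto simp: set_integrable_def)
  ultimately have "(LINT z:?B|lborel. norm z powr q * h z) = H - q * H / (n + q)" by simp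
  also have "\<dots> = n * H / (n + q)" using q by (simp add: field_simps)
  finally show ?thesis using q by (simp add: H_def n_def)
qed

text \<open>The surface measure is a scaled pushforward from the punctured closed ball, so this is
  the transformation formula; the origin and the unit sphere are null, which permits the open ball.
  Nonnegativity of \<open>h\<close> lets both integrals be computed in
  \<open>ennreal\<close>.\<close>

lemma integral_surface_measure:
  fixes h :: "real^'n \<Rightarrow> real"
  assumes [measurable]: "h \<in> borel_measurable borel" and h: "\<And>z. 0 \<le> h z"
  shows "(LINT \<theta>|surface_measure. h \<theta>)
    = CARD('n) * (LINT z:ball 0 1|lborel. h (z /\<^sub>R norm z))"
proof -
  let ?B = "cball 0 1 - {0} :: (real^'n) set"
  let ?g = "\<lambda>x::real^'n. x /\<^sub>R norm x"
  let ?S = "restrict_space borel (sphere 0 1) :: (real^'n) measure"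
  have g: "?g \<in> restrict_space lborel ?B \<rightarrow>\<^sub>M ?S"
    by (rule measurable_restrict_space2)
      (auto simp: space_restrict_space intro: measurable_restrict_space1)
  have hS: "h \<in> borel_measurable ?S"
    by (rule measurable_restrict_space1) simp
  have "(\<integral>\<^sup>+\<theta>. ennreal (h \<theta>) \<partial>surface_measure)
      = of_nat CARD('n) * (\<integral>\<^sup>+x. ennreal (h (?g x)) \<partial>restrict_space lborel ?B)"
    unfolding surface_measure_def using hS g
    by (simp add: nn_integral_scale_measure nn_integral_distr)
  also have "(\<integral>\<^sup>+x. ennreal (h (?g x)) \<partial>restrict_space lborel ?B)
      = (\<integral>\<^sup>+x. ennreal (h (?g x)) * indicator ?B x \<partial>lborel)"
    by (rule nn_integral_restrict_space) simp
  also have "\<dots> = (\<integral>\<^sup>+x. ennreal (indicator (ball 0 1) x *\<^sub>R h (?g x)) \<partial>lborel)"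
  proof (rule nn_integral_cong_AE)
    have "sphere (0::real^'n) 1 \<in> null_sets lebesgue"
      using negligible_sphere negligible_iff_null_sets by blast
    then have "sphere (0::real^'n) 1 \<in> null_sets lborel"
      by (subst (asm) null_sets_completion_iff) simp_all
    then have "AE x::real^'n in lborel. x \<notin> sphere 0 1"
      by (rule AE_not_in)
    then show "AE x in lborel. ennreal (h (?g x)) * indicator ?B x
        = ennreal (indicator (ball 0 1) x *\<^sub>R h (?g x))"
      using AE_lborel_singleton[of "0::real^'n"]
      by eventually_elim (auto simp: indicator_def)
  qed
  finally have nn: "(\<integral>\<^sup>+\<theta>. ennreal (h \<theta>) \<partial>surface_measure)
      = of_nat CARD('n) * (\<integral>\<^sup>+x. ennreal (indicator (ball 0 1) x *\<^sub>R h (?g x)) \<partial>lborel)" .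
  have "(LINT \<theta>|surface_measure. h \<theta>) = enn2real (\<integral>\<^sup>+\<theta>. ennreal (h \<theta>) \<partial>surface_measure)"
    by (rule integral_eq_nn_integral) (use hS h in \<open>auto simp: measurable_cong_sets[OF sets_surface_measure refl]\<close>)
  also have "\<dots> = CARD('n) * enn2real (\<integral>\<^sup>+x. ennreal (indicator (ball 0 1) x *\<^sub>R h (?g x)) \<partial>lborel)"
    by (simp add: nn enn2real_mult)
  also have "\<dots> = CARD('n) * (LINT z:ball 0 1|lborel. h (?g z))"
    unfolding set_lebesgue_integral_def by (subst integral_eq_nn_integral) (simp_all add: h)
  finally show ?thesis .
qed

text \<open>With \<open>n = CARD('n)\<close>, homogeneity gives \<open>(n + q) * I = n * J\<close>,
  while the cone description of the surface measure gives \<open>K_sphere q e = n * J\<close> and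
  total mass \<open>n\<close> times the volume of the ball. The constants then match.\<close>

lemma K_ball_eq_K_sphere:
  fixes e :: "real^'n"
  assumes "1 \<le> q" "norm e = 1"
  shows "K_ball q e =
    (real CARD('n) / ((real CARD('n) + q) *
       measure (surface_measure :: (real^'n) measure) (sphere 0 1)) * K_sphere q e) powr (1 / q)"
proof -
  let ?B = "ball 0 1 :: (real^'n) set"
  \<comment> \<open>The extension of \<open>\<bar>e \<bullet> \<theta>\<bar> powr q\<close> from the
    sphere that is constant along rays; its value at 0 is 0, because
    \<open>inverse 0 = 0\<close>.\<close>
  define h where "h = (\<lambda>z::real^'n. \<bar>e \<bullet> (z /\<^sub>R norm z)\<bar> powr q)"
  define I where "I = (LINT z:?B|lborel. \<bar>e \<bullet> z\<bar> powr q)"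
  define J where "J = (LINT z:?B|lborel. h z)"
  have h_borel: "h \<in> borel_measurable borel"
    unfolding h_def by simp
  have h_nonneg: "0 \<le> h z" for z
    by (simp add: h_def)
  have h_scale: "h (s *\<^sub>R z) = h z" if "0 < s" for s z
    using that by (simp add: h_def abs_mult field_simps)
  have h_le: "h z \<le> 1" for z
  proof -
    have "\<bar>e \<bullet> (z /\<^sub>R norm z)\<bar> \<le> 1"
      using Cauchy_Schwarz_ineq2[of e "z /\<^sub>R norm z"] assms(2) by (cases "z = 0") simp_all
    then show ?thesis
      using powr_mono2[of q _ 1] assms(1) by (simp add: h_def)
  qed
  have abs_eq: "norm z * \<bar>e \<bullet> (z /\<^sub>R norm z)\<bar> = \<bar>e \<bullet> z\<bar>" for z
    by (cases "z = 0") (simp_all add: abs_mult)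
  have "norm z powr q * h z = \<bar>e \<bullet> z\<bar> powr q" for z
    by (simp only: h_def abs_eq flip: powr_mult)
  then have IJ: "(CARD('n) + q) * I = CARD('n) * J"
    using set_integral_ball_norm_powr[OF h_borel h_nonneg h_le h_scale assms(1)]
    by (simp add: I_def J_def)
  \<comment> \<open>The total mass is the surface integral of the constant 1.\<close>
  have sphere: "measure (surface_measure :: (real^'n) measure) (sphere 0 1) = CARD('n) * measure lborel ?B"
    using integral_surface_measure[of "\<lambda>_::real^'n. 1"] by (simp add: set_lebesgue_integral_def)
  have "K_sphere q e = CARD('n) * J"
    unfolding K_sphere_def J_def h_def by (rule integral_surface_measure) simp_all
  then have "real CARD('n) / ((real CARD('n) + q) *
       measure (surface_measure :: (real^'n) measure) (sphere 0 1)) * K_sphere q e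
     = 1 / measure lborel ?B * (CARD('n) * J / (CARD('n) + q))"
    by (simp add: sphere)
  also have "CARD('n) * J / (CARD('n) + q) = I"
    using assms(1) by (simp flip: IJ)
  also have "1 / measure lborel ?B * I = average ?B (\<lambda>z. \<bar>e \<bullet> z\<bar> powr q)"
    by (simp add: average_lborel I_def)
  finally show ?thesis
    by (simp add: K_ball_def)
qed

section \<open>The pointwise limit and the two forms of the constant\<close>

theorem theorem3p8:
  fixes f :: "real^'n \<Rightarrow> real" and e :: "real^'n" and q :: real
  assumes "1 \<le> q" and "C1_compact_support f" and "norm e = 1"
  shows "(\<forall>x. ((\<lambda>t. mean_osc q f x t / t) \<longlongrightarrow> K_ball q e * norm (gradient f x)) (at_right 0)) \<and>
         K_ball q e =
           (real CARD('n) / ((real CARD('n) + q) *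
              measure (surface_measure :: (real^'n) measure) (sphere 0 1)) * K_sphere q e) powr (1 / q)"
proof (intro conjI allI)
  have diff: "f differentiable (at x)" for x
    using assms(2) by (simp add: C1_compact_support_def)
  then have "continuous_on UNIV f"
    by (simp add: continuous_on_eq_continuous_within differentiable_imp_continuous_within)
  then show "((\<lambda>t. mean_osc q f x t / t) \<longlongrightarrow> K_ball q e * norm (gradient f x)) (at_right 0)" for x
    by (rule tendsto_mean_osc_over_radius[OF assms(1) _ GDERIV_gradient[OF diff] assms(3)])
qed (rule K_ball_eq_K_sphere[OF assms(1,3)])

end
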